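(* For any $r>0$, the metric projection $P_{C_M(r)}:H\to C_M(r)$ satisfies: (a) $P_{C_M(r)}$ is Fréchet differentiable on $C_M^o(r)$ and, for any $x\in C_M^o(r)$, $$P'_{C_M(r)}(x)(h)=h,\quad\text{for any }h\in H\setminus\{\theta\}.$$ (b) $P_{C_M(r)}$ is Fréchet differentiable on $H\setminus C_M(r)$ and, for any $x\in H\setminus C_M(r)$, $$P'_{C_M(r)}(x)(h)=\frac{r}{\|x_M\|}\left(h_M-\frac{\langle x_M,h_M\rangle}{\|x_M\|^2}x_M\right)+h_{N\setminus M},\quad\text{for any }h\in H\setminus\{\theta\}.$$ In particular, $P'_{C_M(r)}(x)(x)=x_{N\setminus M}$ for any $x\in H\setminus C_M(r)$.
   Context: $(H,\|\cdot\|)$ is a real Hilbert space with inner product $\langle\cdot,\cdot\rangle$, zero vector $\theta$, and an orthonormal basis $\{e_n\}_{n\in N}$, where $N$ is a set of positive integers with cardinality greater than $1$. $M$ is a nonempty subset of $N$. For $x\in H$, $x_M=\sum_{m\in M}\langle x,e_m\rangle e_m$ and $x_{N\setminus M}=\sum_{n\in N\setminus M}\langle x,e_n\rangle e_n$. For $r>0$, $C_M(r)=\{x\in H:\|x_M\|\le r\}$ and $C_M^o(r)=\{x\in H:\|x_M\|<r\}$. For a nonempty closed convex $C\subseteq H$, $P_C:H\to C$ is the metric projection ($P_Cx$ is the unique point of $C$ nearest to $x$). $P_C$ is (Gâteaux) directionally differentiable at $x$ if for every $v\in H$, $v\neq\theta$, the limit $P_C'(x)(v)=\lim_{t\downarrow0}\frac{P_C(x+tv)-P_C(x)}{t}$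 exists (in norm). $P_C$ is called Fréchet differentiable at $x$ if moreover this limit is attained uniformly for $v$ in the unit sphere of $H$; it is Fréchet differentiable on a set $D\subseteq H$ if it is so at every point of $D$. *)

theory Defs
  imports "HOL-Analysis.Analysis"
begin

definition orthonormal_basis :: "nat set \<Rightarrow> (nat \<Rightarrow> 'a::real_inner) \<Rightarrow> bool" where
  "orthonormal_basis N e \<longleftrightarrow>
     (\<forall>m\<in>N. \<forall>n\<in>N. e m \<bullet> e n = (if m = n then 1 else 0)) \<and> closure (span (e ` N)) = UNIV"

definition coord_part :: "(nat \<Rightarrow> 'a::real_inner) \<Rightarrow> nat set \<Rightarrow> 'a \<Rightarrow> 'a" where
  "coord_part e M x = (\<Sum>\<^sub>\<infinity>m\<in>M. (x \<bullet> e m) *\<^sub>R e m)"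

definition closed_cylinder :: "(nat \<Rightarrow> 'a::real_inner) \<Rightarrow> nat set \<Rightarrow> real \<Rightarrow> 'a set" where
  "closed_cylinder e M r = {x. norm (coord_part e M x) \<le> r}"

definition open_cylinder :: "(nat \<Rightarrow> 'a::real_inner) \<Rightarrow> nat set \<Rightarrow> real \<Rightarrow> 'a set" where
  "open_cylinder e M r = {x. norm (coord_part e M x) < r}"

text \<open>The library's \<^const>\<open>closest_point\<close> requires the sort \<open>heine_borel\<close>, which
  excludes infinite-dimensional Hilbert spaces.  The description below is meaningful when the
  nearest point exists uniquely, as for a nonempty closed convex set in a Hilbert space.\<close>

definition metric_projection :: "'a::metric_space set \<Rightarrow> 'a \<Rightarrow> 'a" where
  "metric_projection C x = (THE y. y \<in> C \<and> (\<forall>z\<in>C. dist x y \<le> dist x z))"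

definition diff_quotient ::
  "('a::real_normed_vector \<Rightarrow> 'b::real_normed_vector) \<Rightarrow> 'a \<Rightarrow> real \<Rightarrow> 'a \<Rightarrow> 'b" where
  "diff_quotient f x t v = (f (x + t *\<^sub>R v) - f x) /\<^sub>R t"

definition directionally_differentiable_at ::
  "('a::real_normed_vector \<Rightarrow> 'b::real_normed_vector) \<Rightarrow> 'a \<Rightarrow> bool" where
  "directionally_differentiable_at f x \<longleftrightarrow>
     (\<forall>v. v \<noteq> 0 \<longrightarrow> (\<exists>d. ((\<lambda>t. diff_quotient f x t v) \<longlongrightarrow> d) (at_right 0)))"

definition directional_deriv ::
  "('a::real_normed_vector \<Rightarrow> 'b::real_normed_vector) \<Rightarrow> 'a \<Rightarrow> 'a \<Rightarrow> 'b" where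
  "directional_deriv f x v = Lim (at_right 0) (\<lambda>t. diff_quotient f x t v)"

text \<open>This is uniform one-sided directional differentiability; unlike for
  \<^const>\<open>has_derivative\<close>, linearity of the derivative in the direction is not part of the
  notion.\<close>

definition frechet_differentiable_at ::
  "('a::real_normed_vector \<Rightarrow> 'b::real_normed_vector) \<Rightarrow> 'a \<Rightarrow> bool" where
  "frechet_differentiable_at f x \<longleftrightarrow>
     directionally_differentiable_at f x \<and>
     uniform_limit (sphere 0 1) (diff_quotient f x) (directional_deriv f x) (at_right 0)"

definition frechet_differentiable_on ::
  "('a::real_normed_vector \<Rightarrow> 'b::real_normed_vector) \<Rightarrow> 'a set \<Rightarrow> bool" where
  "frechet_differentiable_on f D \<longleftrightarrow> (\<forall>x\<in>D. frechet_differentiable_at f x)"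

end

(* The map x \<mapsto> x_M is an orthogonal projection P, so the cylinder is {x. norm (P x) \<le> r} and its
   metric projection only rescales the P-component: it is the identity on the cylinder and
   x \<mapsto> (r / norm (P x)) P x + (x - P x) outside, as the variational inequality
   (x - y) \<bullet> (z - y) \<le> 0 confirms.  Both formulas hold on open sets, so ordinary (full) derivatives
   can be computed there, and these imply the uniform one-sided notion. *)

theory Submission
  imports Defs
begin

section \<open>Uniform one-sided limits of difference quotients from full derivatives\<close>

lemma has_derivative_diff_quotient:
  fixes f :: "'a::real_normed_vector \<Rightarrow> 'b::real_normed_vector"
  assumes f: "(f has_derivative f') (at x)"
  shows "uniform_limit (cball 0 B) (diff_quotient f x) f' (at_right 0)"
proof (rule uniform_limitI)
  fix \<epsilon> :: real assume "\<epsilon> > 0"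
  \<comment> \<open>\<open>C\<close> is positive and exceeds \<open>B\<close> whatever the sign of
    \<open>B\<close>, so dividing by it is safe.\<close>
  define C where "C = \<bar>B\<bar> + 1"
  have C: "C > 0" "B < C" by (auto simp: C_def)
  interpret f': bounded_linear f' using f by (rule has_derivative_bounded_linear)
  \<comment> \<open>An increment \<open>t *\<^sub>R v\<close> has norm at most \<open>t * C\<close>,
    so this accuracy leaves an error of at most \<open>\<epsilon> / 2\<close> after division by
    \<open>t\<close>, uniformly in \<open>v\<close>; the halving gives the strict bound.\<close>
  have "\<epsilon> / (2 * C) > 0" using \<open>\<epsilon> > 0\<close> C by simp
  then obtain d where d: "d > 0"
    and fd: "\<And>y. norm (y - x) < d \<Longrightarrow>
      norm (f y - f x - f' (y - x)) \<le> \<epsilon> / (2 * C) * norm (y - x)"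
    using f unfolding has_derivative_at_alt by blast
  have "dist (diff_quotient f x t v) (f' v) < \<epsilon>"
    if t: "0 < t" "t < d / C" and v: "v \<in> cball 0 B" for t v
  proof -
    have nv: "norm v \<le> C" using v C by simp
    have "t * norm v \<le> t * C" using nv t by simp
    also have "\<dots> < d" using t C by (simp add: field_simps)
    finally have "norm ((x + t *\<^sub>R v) - x) < d" using t by simp
    from fd[OF this] have le: "norm (f (x + t *\<^sub>R v) - f x - t *\<^sub>R f' v) \<le> \<epsilon> / (2 * C) * (t * norm v)"
      using t by (simp add: f'.scaleR)
    have "diff_quotient f x t v - f' v = (f (x + t *\<^sub>R v) - f x - t *\<^sub>R f' v) /\<^sub>R t"
      using t by (simp add: diff_quotient_def scaleR_diff_right)
    then have "dist (diff_quotient f x t v) (f' v) = norm (f (x + t *\<^sub>R v) - f x - t *\<^sub>R f' v) / t"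
      using t by (simp add: dist_norm divide_inverse_commute)
    also have "\<dots> \<le> \<epsilon> / (2 * C) * (t * norm v) / t"
      using le t by (intro divide_right_mono) auto
    also have "\<dots> = \<epsilon> / (2 * C) * norm v" using t by simp
    also have "\<dots> \<le> \<epsilon> / (2 * C) * C"
      using nv C \<open>\<epsilon> > 0\<close> by (intro mult_left_mono) auto
    also have "\<dots> < \<epsilon>" using C \<open>\<epsilon> > 0\<close> by simp
    finally show ?thesis .
  qed
  moreover have "d / C > 0" using d C by simp
  ultimately show "\<forall>\<^sub>F t in at_right 0. \<forall>v\<in>cball 0 B. dist (diff_quotient f x t v) (f' v) < \<epsilon>"
    unfolding eventually_at_right_field by blast
qed

lemma has_derivative_imp_tendsto_diff_quotient:
  fixes f :: "'a::real_normed_vector \<Rightarrow> 'b::real_normed_vector"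
  assumes "(f has_derivative f') (at x)"
  shows "((\<lambda>t. diff_quotient f x t v) \<longlongrightarrow> f' v) (at_right 0)"
  by (rule tendsto_uniform_limitI[OF has_derivative_diff_quotient[OF assms, of "norm v"]]) simp

text \<open>An equality of functions, direction 0 included, so that it can rewrite the limit
  function inside \<open>frechet_differentiable_at\<close>. The \<open>Lim\<close> is determined
  because \<open>at_right 0\<close> is a nontrivial filter.\<close>

lemma has_derivative_imp_directional_deriv:
  fixes f :: "'a::real_normed_vector \<Rightarrow> 'b::real_normed_vector"
  assumes "(f has_derivative f') (at x)"
  shows "directional_deriv f x = f'"
  unfolding directional_deriv_def
  by (intro ext tendsto_Lim has_derivative_imp_tendsto_diff_quotient[OF assms]) simp

lemma has_derivative_imp_frechet_differentiable_at:
  fixes f :: "'a::real_normed_vector \<Rightarrow> 'b::real_normed_vector"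
  assumes "(f has_derivative f') (at x)"
  shows "frechet_differentiable_at f x"
  unfolding frechet_differentiable_at_def directionally_differentiable_at_def
    has_derivative_imp_directional_deriv[OF assms]
  using has_derivative_imp_tendsto_diff_quotient[OF assms]
    uniform_limit_on_subset[OF has_derivative_diff_quotient[OF assms, of 1], of "sphere 0 1"]
  by auto

section \<open>Nearest points from the variational inequality\<close>

lemma metric_projection_eqI:
  fixes x y :: "'a::real_inner"
  assumes "y \<in> C" and obtuse: "\<And>z. z \<in> C \<Longrightarrow> (x - y) \<bullet> (z - y) \<le> 0"
  shows "metric_projection C x = y"
  unfolding metric_projection_def
proof (rule the_equality)
  \<comment> \<open>Expanding \<open>x - z = (x - y) - (z - y)\<close> turns the obtuse angle into a
    Pythagorean inequality. Its extra term \<open>(dist z y)\<^sup>2\<close> yields minimality of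
    \<open>y\<close> and, for a second minimiser \<open>z\<close>, forces \<open>z = y\<close>; the
    definite description needs both.\<close>
  have *: "(dist x y)\<^sup>2 + (dist z y)\<^sup>2 \<le> (dist x z)\<^sup>2" if "z \<in> C" for z
  proof -
    have "x - z = (x - y) - (z - y)" by simp
    then have "(dist x z)\<^sup>2 = (dist x y)\<^sup>2 + (dist z y)\<^sup>2 - 2 * ((x - y) \<bullet> (z - y))"
      unfolding dist_norm power2_norm_eq_inner
      by (simp only:) (simp add: inner_diff inner_commute algebra_simps)
    then show ?thesis using obtuse[OF that] by simp
  qed
  have "dist x y \<le> dist x z" if "z \<in> C" for z
  proof (rule power2_le_imp_le)
    show "(dist x y)\<^sup>2 \<le> (dist x z)\<^sup>2" using *[OF that] zero_le_power2[of "dist z y"] by linarith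
  qed simp
  then show "y \<in> C \<and> (\<forall>z\<in>C. dist x y \<le> dist x z)" using \<open>y \<in> C\<close> by blast
  fix z assume z: "z \<in> C \<and> (\<forall>w\<in>C. dist x z \<le> dist x w)"
  then have "(dist x z)\<^sup>2 \<le> (dist x y)\<^sup>2" using \<open>y \<in> C\<close> by (intro power_mono) auto
  with *[of z] z have "(dist z y)\<^sup>2 \<le> 0" by linarith
  then show "z = y" by simp
qed

section \<open>Cylinders over an abstract orthogonal projection\<close>

locale orthogonal_projection =
  fixes P :: "'a::real_inner \<Rightarrow> 'a"
  assumes linear: "linear P"
    and orthogonal: "P x \<bullet> (y - P y) = 0"
begin

lemma inner_left_eq: "P x \<bullet> y = P x \<bullet> P y"
  using orthogonal[of x y] by (simp add: inner_diff_right)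

text \<open>The vector \<open>P x - P (P x)\<close> is both a difference of values of
  \<open>P\<close> and a residual \<open>y - P y\<close> with \<open>y = P x\<close>, hence
  orthogonal to itself.\<close>

lemma idempotent [simp]: "P (P x) = P x"
proof -
  have "(P x - P (P x)) \<bullet> (P x - P (P x)) = 0"
    using orthogonal[of x "P x"] orthogonal[of "P x" "P x"] by (simp add: inner_diff_left)
  then show ?thesis by simp
qed

text \<open>Cauchy-Schwarz applied to \<open>P x \<bullet> x\<close>, which equals the squared norm
  of \<open>P x\<close>. This bound makes \<open>P\<close> a bounded linear map, hence continuous
  and its own derivative.\<close>

lemma norm_le: "norm (P x) \<le> norm x"
proof -
  have "norm (P x) * norm (P x) = P x \<bullet> x"
    by (simp add: inner_left_eq flip: power2_norm_eq_inner power2_eq_square)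
  also have "\<dots> \<le> norm (P x) * norm x" by (rule norm_cauchy_schwarz)
  finally show ?thesis
    by (cases "P x = 0") auto
qed

sublocale bounded_linear P
  by (rule bounded_linear_intro[where K = 1])
    (auto simp: linear_add[OF linear] linear_scale[OF linear] norm_le)

lemma metric_projection_inside:
  assumes "norm (P x) \<le> r"
  shows "metric_projection {x. norm (P x) \<le> r} x = x"
  by (rule metric_projection_eqI) (use assms in auto)

lemma metric_projection_outside:
  assumes "norm (P x) > r" and "r > 0"
  shows "metric_projection {x. norm (P x) \<le> r} x = (r / norm (P x)) *\<^sub>R P x + (x - P x)"
    (is "_ = ?y")
proof (rule metric_projection_eqI)
  have pos: "norm (P x) > 0" using assms by linarith
  have Py: "P ?y = (r / norm (P x)) *\<^sub>R P x" by (simp add: add diff scaleR)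
  then show "?y \<in> {x. norm (P x) \<le> r}" using assms pos by simp
  fix z assume "z \<in> {x. norm (P x) \<le> r}"
  then have z: "norm (P z) \<le> r" by simp
  \<comment> \<open>The displacement is a nonnegative multiple of \<open>P x\<close>, so only the
    sign of \<open>P x \<bullet> (z - ?y)\<close> matters; since \<open>P ?y\<close> is
    \<open>P x\<close> rescaled to norm \<open>r\<close>, Cauchy-Schwarz with
    \<open>norm (P z) \<le> r\<close> decides it.\<close>
  have xy: "x - ?y = (1 - r / norm (P x)) *\<^sub>R P x"
    by (simp add: algebra_simps)
  have "P x \<bullet> (z - ?y) = P x \<bullet> P z - r * norm (P x)"
    unfolding inner_left_eq[of x "z - ?y"] diff Py
    using pos by (simp add: inner_diff_right power2_eq_square flip: power2_norm_eq_inner)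
  also have "P x \<bullet> P z \<le> norm (P x) * r"
    using norm_cauchy_schwarz[of "P x" "P z"] mult_left_mono[OF z, of "norm (P x)"] by simp
  finally have "P x \<bullet> (z - ?y) \<le> 0" by (simp add: mult.commute)
  moreover have "1 - r / norm (P x) \<ge> 0" using assms pos by (simp add: field_simps)
  ultimately show "(x - ?y) \<bullet> (z - ?y) \<le> 0"
    unfolding xy inner_scaleR_left by (rule mult_nonneg_nonpos[rotated])
qed

lemma has_derivative_metric_projection_inside:
  assumes "norm (P x) < r"
  shows "(metric_projection {x. norm (P x) \<le> r} has_derivative (\<lambda>h. h)) (at x)"
proof (rule has_derivative_transform_within_open[of "\<lambda>x. x" _ _ _ "{x. norm (P x) < r}"])
  show "open {x. norm (P x) < r}"
    by (intro open_Collect_less continuous_on_norm continuous_on continuous_on_const continuous_on_id)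
qed (use assms in \<open>auto simp: metric_projection_inside\<close>)

lemma has_derivative_metric_projection_outside:
  assumes "norm (P x) > r" and "r > 0"
  shows "(metric_projection {x. norm (P x) \<le> r} has_derivative
    (\<lambda>h. (r / norm (P x)) *\<^sub>R (P h - ((P x \<bullet> P h) / (norm (P x))\<^sup>2) *\<^sub>R P x) + (h - P h))) (at x)"
proof (rule has_derivative_transform_within_open
    [of "\<lambda>x. (r / norm (P x)) *\<^sub>R P x + (x - P x)" _ _ _ "{x. r < norm (P x)}"])
  show "open {x. r < norm (P x)}"
    by (intro open_Collect_less continuous_on_norm continuous_on continuous_on_const continuous_on_id)
  \<comment> \<open>The norm is differentiable only away from 0, and \<open>P x\<close> is nonzero
    because its norm exceeds \<open>r > 0\<close>.\<close>
  have nz: "P x \<noteq> 0" using assms by auto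
  then have nz': "norm (P x) \<noteq> 0" by simp
  have P': "(P has_derivative P) (at x)" by (rule bounded_linear_imp_has_derivative) unfold_locales
  have N': "((\<lambda>x. norm (P x)) has_derivative (\<lambda>h. P h \<bullet> sgn (P x))) (at x)"
    using has_derivative_compose[OF P' has_derivative_norm[OF nz]] by simp
  show "((\<lambda>x. (r / norm (P x)) *\<^sub>R P x + (x - P x)) has_derivative
    (\<lambda>h. (r / norm (P x)) *\<^sub>R (P h - ((P x \<bullet> P h) / (norm (P x))\<^sup>2) *\<^sub>R P x) + (h - P h))) (at x)"
    \<comment> \<open>The product and quotient rules compute a derivative containing
      \<open>sgn (P x)\<close>; writing it as \<open>P x\<close> divided by its norm gives the
      stated form.\<close>
    by (rule has_derivative_eq_rhs, (rule P' N' nz' derivative_intros)+)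
      (use nz in \<open>auto simp: fun_eq_iff sgn_div_norm inner_commute power2_eq_square
        algebra_simps divide_simps\<close>)
qed (use assms in \<open>auto simp: metric_projection_outside\<close>)

end

section \<open>Coordinate parts with respect to an orthonormal basis\<close>

context
  fixes e :: "nat \<Rightarrow> 'a::{real_inner, complete_space}" and N :: "nat set"
  assumes basis: "orthonormal_basis N e"
begin

lemma basis_inner: "m \<in> N \<Longrightarrow> n \<in> N \<Longrightarrow> e m \<bullet> e n = (if m = n then 1 else 0)"
  using basis by (simp add: orthonormal_basis_def)

text \<open>The closed hyperplane orthogonal to \<open>x - y\<close> contains the basis, hence its
  dense span, hence \<open>x - y\<close> itself. Later vector identities are checked coordinatewise
  through this.\<close>

lemma eq_if_coords_eq:
  assumes "\<And>n. n \<in> N \<Longrightarrow> x \<bullet> e n = y \<bullet> e n"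
  shows "x = y"
proof -
  let ?S = "{v. (x - y) \<bullet> v = 0}"
  have "e ` N \<subseteq> ?S" using assms by (auto simp: inner_diff_left)
  then have "span (e ` N) \<subseteq> ?S" by (rule span_minimal) (rule subspace_hyperplane)
  then have "closure (span (e ` N)) \<subseteq> ?S"
    by (rule closure_minimal) (rule closed_hyperplane)
  moreover have "closure (span (e ` N)) = UNIV"
    using basis by (simp add: orthonormal_basis_def)
  ultimately have "x - y \<in> ?S" by blast
  then show ?thesis by simp
qed

lemma norm_basis_sum:
  assumes "finite F" "F \<subseteq> N"
  shows "(norm (\<Sum>m\<in>F. c m *\<^sub>R e m))\<^sup>2 = (\<Sum>m\<in>F. (c m)\<^sup>2)"
proof -
  have "(norm (\<Sum>m\<in>F. c m *\<^sub>R e m))\<^sup>2 = (\<Sum>m\<in>F. (norm (c m *\<^sub>R e m))\<^sup>2)"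
    using assms
    by (intro norm_sum_Pythagorean) (auto simp: pairwise_def orthogonal_def basis_inner subset_iff)
  also have "\<dots> = (\<Sum>m\<in>F. (c m)\<^sup>2)"
  proof (rule sum.cong)
    fix m assume "m \<in> F"
    then have "norm (e m) = 1" using assms basis_inner[of m m] by (auto simp: norm_eq_sqrt_inner)
    then show "(norm (c m *\<^sub>R e m))\<^sup>2 = (c m)\<^sup>2" by simp
  qed simp
  finally show ?thesis .
qed

text \<open>With \<open>s\<close> the partial sum, \<open>x \<bullet> s\<close> and
  \<open>s \<bullet> s\<close> both equal the sum of squares; expand the nonnegative
  \<open>(x - s) \<bullet> (x - s)\<close>.\<close>

lemma Bessel_inequality:
  assumes "finite F" "F \<subseteq> N"
  shows "(\<Sum>m\<in>F. (x \<bullet> e m)\<^sup>2) \<le> (norm x)\<^sup>2"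
proof -
  let ?s = "\<Sum>m\<in>F. (x \<bullet> e m) *\<^sub>R e m"
  have "x \<bullet> ?s = (\<Sum>m\<in>F. (x \<bullet> e m)\<^sup>2)"
    by (simp add: inner_sum_right power2_eq_square)
  moreover have "?s \<bullet> ?s = (\<Sum>m\<in>F. (x \<bullet> e m)\<^sup>2)"
    using norm_basis_sum[OF assms, of "\<lambda>m. x \<bullet> e m"] by (simp add: power2_norm_eq_inner)
  moreover have "(x - ?s) \<bullet> (x - ?s) \<ge> 0" by simp
  ultimately show ?thesis
    by (simp add: power2_norm_eq_inner inner_diff inner_commute)
qed

text \<open>Riesz-Fischer: square-summability makes the net of finite partial sums Cauchy, and
  completeness of the space makes it converge.\<close>

lemma summable_on_basis:
  assumes "M \<subseteq> N" and c: "(\<lambda>m. (c m)\<^sup>2) summable_on M"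
  shows "(\<lambda>m. c m *\<^sub>R e m) summable_on M"
proof -
  let ?S = "\<lambda>F. \<Sum>m\<in>F. c m *\<^sub>R e m" and ?C = "\<lambda>F. \<Sum>m\<in>F. (c m)\<^sup>2"
  have "cauchy_filter (filtermap ?S (finite_subsets_at_top M))"
    unfolding cauchy_filter_metric_filtermap
  proof (intro allI impI)
    fix \<epsilon> :: real assume "\<epsilon> > 0"
    define L where "L = infsum (\<lambda>m. (c m)\<^sup>2) M"
    have "(?C \<longlongrightarrow> L) (finite_subsets_at_top M)"
      using has_sum_infsum[OF c] unfolding has_sum_def L_def .
    then have "\<forall>\<^sub>F F in finite_subsets_at_top M. L - (\<epsilon> / 2)\<^sup>2 < ?C F"
      by (rule order_tendstoD) (use \<open>\<epsilon> > 0\<close> in simp)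
    \<comment> \<open>\<open>F0\<close> captures all but less than
      \<open>(\<epsilon> / 2)\<^sup>2\<close> of the sum of squares. By Pythagoras every larger
      finite set has its partial sum within \<open>\<epsilon> / 2\<close> of that of
      \<open>F0\<close>, so any two differ by less than \<open>\<epsilon>\<close>.\<close>
    then obtain F0 where F0: "finite F0" "F0 \<subseteq> M" "L - (\<epsilon> / 2)\<^sup>2 < ?C F0"
      unfolding eventually_finite_subsets_at_top by blast
    define Q where "Q F \<longleftrightarrow> finite F \<and> F0 \<subseteq> F \<and> F \<subseteq> M" for F
    have close: "dist (?S F) (?S F0) < \<epsilon> / 2" if "Q F" for F
    proof -
      have F: "finite F" "F0 \<subseteq> F" "F \<subseteq> M" using that by (auto simp: Q_def)
      have "(dist (?S F) (?S F0))\<^sup>2 = (norm (?S (F - F0)))\<^sup>2"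
        using F by (simp add: dist_norm sum_diff)
      also have "\<dots> = ?C (F - F0)"
        using F assms by (intro norm_basis_sum) auto
      also have "\<dots> = ?C F - ?C F0" using F by (simp add: sum_diff)
      also have "?C F \<le> L"
        unfolding L_def by (rule finite_sum_le_infsum) (use F c in auto)
      finally have "(dist (?S F) (?S F0))\<^sup>2 < (\<epsilon> / 2)\<^sup>2" using F0 by linarith
      then show ?thesis by (rule power2_less_imp_less) (use \<open>\<epsilon> > 0\<close> in simp)
    qed
    have "eventually Q (finite_subsets_at_top M)"
      unfolding eventually_finite_subsets_at_top Q_def using F0 by blast
    moreover have "dist (?S F) (?S G) < \<epsilon>" if "Q F" "Q G" for F G
      using dist_triangle2[of "?S F" "?S G" "?S F0"] close[OF that(1)] close[OF that(2)] by linarith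
    ultimately show "\<exists>Q. eventually Q (finite_subsets_at_top M) \<and>
        (\<forall>F G. Q F \<and> Q G \<longrightarrow> dist (?S F) (?S G) < \<epsilon>)"
      by blast
  qed
  then have "convergent_filter (filtermap ?S (finite_subsets_at_top M))"
    by (rule cauchy_filter_convergent)
  then show ?thesis
    by (auto simp: convergent_filter_iff summable_on_def has_sum_def filterlim_def)
qed

context
  fixes M :: "nat set"
  assumes subset: "M \<subseteq> N"
begin

text \<open>Bessel bounds the finite sums of squared coefficients, so the series is summable and
  \<open>infsum\<close> in \<open>coord_part\<close> never falls back to its default 0.\<close>

lemma has_sum_coord_part: "((\<lambda>m. (x \<bullet> e m) *\<^sub>R e m) has_sum coord_part e M x) M"
proof -
  have "(\<lambda>m. (x \<bullet> e m)\<^sup>2) summable_on M"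
    by (rule nonneg_bdd_above_summable_on)
      (use subset in \<open>auto intro!: bdd_aboveI[where M = "(norm x)\<^sup>2"] Bessel_inequality\<close>)
  then have "(\<lambda>m. (x \<bullet> e m) *\<^sub>R e m) summable_on M"
    by (rule summable_on_basis[OF subset])
  then show ?thesis unfolding coord_part_def by (rule has_sum_infsum)
qed

lemma has_sum_inner_coord_part:
  "((\<lambda>m. (x \<bullet> e m) * (e m \<bullet> y)) has_sum (coord_part e M x \<bullet> y)) M"
  using has_sum_bounded_linear[OF bounded_linear_inner_left has_sum_coord_part] by simp

lemma coord_part_inner_basis:
  assumes "n \<in> N"
  shows "coord_part e M x \<bullet> e n = (if n \<in> M then x \<bullet> e n else 0)"
proof (rule has_sum_unique[OF has_sum_inner_coord_part])
  \<comment> \<open>Only the index \<open>n\<close> can contribute, so the sum over \<open>M\<close>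
    collapses to \<open>M \<inter> {n}\<close>, which is empty or a singleton.\<close>
  have "((\<lambda>m. (x \<bullet> e m) * (e m \<bullet> e n)) has_sum (\<Sum>m\<in>M \<inter> {n}. (x \<bullet> e m) * (e m \<bullet> e n))) (M \<inter> {n})"
    by (rule has_sum_finite) simp
  also have "?this \<longleftrightarrow> ((\<lambda>m. (x \<bullet> e m) * (e m \<bullet> e n)) has_sum (\<Sum>m\<in>M \<inter> {n}. (x \<bullet> e m) * (e m \<bullet> e n))) M"
    by (rule has_sum_cong_neutral) (use subset assms in \<open>auto simp: basis_inner\<close>)
  also have "(\<Sum>m\<in>M \<inter> {n}. (x \<bullet> e m) * (e m \<bullet> e n)) = (if n \<in> M then x \<bullet> e n else 0)"
    using assms by (auto simp: basis_inner)
  finally show "((\<lambda>m. (x \<bullet> e m) * (e m \<bullet> e n)) has_sum (if n \<in> M then x \<bullet> e n else 0)) M" .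
qed

text \<open>Linearity is compared coordinatewise. For orthogonality, every term of the series
  vanishes because \<open>y - coord_part e M y\<close> has zero coordinates on
  \<open>M\<close>.\<close>

lemma orthogonal_projection_coord_part: "orthogonal_projection (coord_part e M)"
proof
  show "coord_part e M (x + y) = coord_part e M x + coord_part e M y" for x y
    by (rule eq_if_coords_eq) (simp add: inner_add_left coord_part_inner_basis)
  show "coord_part e M (a *\<^sub>R x) = a *\<^sub>R coord_part e M x" for a x
    by (rule eq_if_coords_eq) (simp add: coord_part_inner_basis)
  show "coord_part e M x \<bullet> (y - coord_part e M y) = 0" for x y
  proof (rule has_sum_unique[OF has_sum_inner_coord_part has_sum_0])
    fix m assume "m \<in> M"
    with subset show "(x \<bullet> e m) * (e m \<bullet> (y - coord_part e M y)) = 0"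
      by (auto simp: inner_commute[of "e m"] inner_diff_left coord_part_inner_basis)
  qed
qed

end

lemma coord_part_complement:
  assumes "M \<subseteq> N"
  shows "coord_part e (N - M) x = x - coord_part e M x"
  by (rule eq_if_coords_eq) (use assms in \<open>auto simp: inner_diff_left coord_part_inner_basis\<close>)

end

theorem theorem6p6:
  fixes e :: "nat \<Rightarrow> 'a::{real_inner, complete_space}"
    and N M :: "nat set" and r :: real
  assumes "N \<subseteq> {0<..}" and "infinite N \<or> card N > 1"
    and "orthonormal_basis N e"
    and "M \<noteq> {}" and "M \<subseteq> N"
    and "r > 0"
  shows
    "frechet_differentiable_on (metric_projection (closed_cylinder e M r)) (open_cylinder e M r) \<and>
     (\<forall>x\<in>open_cylinder e M r. \<forall>h. h \<noteq> 0 \<longrightarrow>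
        directional_deriv (metric_projection (closed_cylinder e M r)) x h = h) \<and>
     frechet_differentiable_on (metric_projection (closed_cylinder e M r)) (- closed_cylinder e M r) \<and>
     (\<forall>x\<in>- closed_cylinder e M r. \<forall>h. h \<noteq> 0 \<longrightarrow>
        directional_deriv (metric_projection (closed_cylinder e M r)) x h =
          (r / norm (coord_part e M x)) *\<^sub>R
            (coord_part e M h
              - ((coord_part e M x \<bullet> coord_part e M h) / (norm (coord_part e M x))\<^sup>2) *\<^sub>R coord_part e M x)
          + coord_part e (N - M) h) \<and>
     (\<forall>x\<in>- closed_cylinder e M r.
        directional_deriv (metric_projection (closed_cylinder e M r)) x x = coord_part e (N - M) x)"
proof -
  interpret orthogonal_projection "coord_part e M"
    using assms by (intro orthogonal_projection_coord_part)
  note compl = coord_part_complement[OF \<open>orthonormal_basis N e\<close> \<open>M \<subseteq> N\<close>]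
  have inside: "(metric_projection (closed_cylinder e M r) has_derivative (\<lambda>h. h)) (at x)"
    if "x \<in> open_cylinder e M r" for x
    using that has_derivative_metric_projection_inside[of x r]
    by (simp add: closed_cylinder_def open_cylinder_def)
  have outside: "(metric_projection (closed_cylinder e M r) has_derivative
      (\<lambda>h. (r / norm (coord_part e M x)) *\<^sub>R
            (coord_part e M h
              - ((coord_part e M x \<bullet> coord_part e M h) / (norm (coord_part e M x))\<^sup>2) *\<^sub>R coord_part e M x)
          + coord_part e (N - M) h)) (at x)"
    if "x \<in> - closed_cylinder e M r" for x
    using that has_derivative_metric_projection_outside[of r x] \<open>r > 0\<close>
    by (simp add: closed_cylinder_def compl)
  have "directional_deriv (metric_projection (closed_cylinder e M r)) x x = coord_part e (N - M) x"
    if x: "x \<in> - closed_cylinder e M r" for x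
  proof -
    \<comment> \<open>For \<open>h = x\<close> the quotient in the derivative formula is 1 once
      \<open>coord_part e M x\<close> is nonzero, so the rescaled bracket cancels and only the
      complementary part remains.\<close>
    have "coord_part e M x \<noteq> 0" using x \<open>r > 0\<close> by (auto simp: closed_cylinder_def)
    then show ?thesis
      by (simp add: has_derivative_imp_directional_deriv[OF outside[OF x]] power2_norm_eq_inner)
  qed
  then show ?thesis
    unfolding frechet_differentiable_on_def
    by (intro conjI ballI allI impI)
      (auto intro: has_derivative_imp_frechet_differentiable_at inside outside
        simp: has_derivative_imp_directional_deriv[OF inside]
          has_derivative_imp_directional_deriv[OF outside])
qed

end
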